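(* Let $(\delta_k)_{k\ge 1}$ be a non-increasing sequence of real numbers with $0<\delta_k<1$ and $\sum_{k}\delta_k=\infty$, let $(\xi_k)_{k\ge1}$ be independent random variables on a probability space with values in $\{0,1\}$ and $\mathbb{P}(\xi_k=1)=\delta_k$, and let $R=\{k\ge 1:\xi_k=1\}$ be the associated random set of integers. Let $f\in L^1(\mathbb{T})$ be in the Khinchin class of the positive integers, and suppose moreover that $f\in L^{\varphi_\beta}(\mathbb{T})$ for some $\beta>1$. Then, almost surely, $f$ belongs to the Khinchin class of the random set $R$.
   Context: $\mathbb{T}=\mathbb{R}/\mathbb{Z}$ with Haar (Lebesgue) measure $m$. The Khinchin class of an infinite set of positive integers $\{u_1<u_2<\cdots\}$ is the class of $f\in L^1(\mathbb{T})$ such that $\lim_{N\to\infty}\frac1N\sum_{n=1}^Nf(u_nx)=\int_{\mathbb{T}}f\,dm$ for $m$-almost every $x$. Under the hypotheses $R$ is almost surely infinite and is enumerated increasingly. The function $\varphi_\beta(x)=x\,(\log(1+x))^\beta$, $x\ge 0$, and $L^{\varphi_\beta}(\mathbb{T})$ is the Orlicz space of measurable $f$ with $\int_{\mathbb{T}}\varphi_\beta(|f|/a)\,dm<\infty$ for some $a>0$. *)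

theory Defs
  imports "HOL-Probability.Probability" "HOL-Library.Infinite_Set"
begin

text \<open>
  Functions on the circle \<open>\<real>/\<int>\<close> are represented by their lifts, the functions of period 1 on the
  real line. Haar measure is the (completed) Lebesgue measure on the fundamental domain \<open>[0,1)\<close>;
  null sets are thus null sets of the circle, and \<open>x \<mapsto> u x\<close> on the circle is multiplication by \<open>u\<close>
  on the line.
\<close>

definition haar_circle :: "real measure" where
  "haar_circle = lebesgue_on {0..<1}"

definition circle_fun :: "(real \<Rightarrow> 'b) \<Rightarrow> bool" where
  "circle_fun f \<longleftrightarrow> (\<forall>x. f (x + 1) = f x)"

definition L1_circle :: "(real \<Rightarrow> complex) set" where
  "L1_circle = {f. circle_fun f \<and> integrable haar_circle f}"

text \<open>
  The term \<open>u\<^sub>n\<close> of the increasing enumeration of \<open>S\<close> is \<open>enumerate S (n - 1)\<close>, since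
  \<^const>\<open>enumerate\<close> starts at index 0. The definition is meaningful only for infinite \<open>S\<close>.
\<close>

definition khinchin_class :: "nat set \<Rightarrow> (real \<Rightarrow> complex) set" where
  "khinchin_class S = {f \<in> L1_circle.
     AE x in haar_circle.
       (\<lambda>N. (\<Sum>n=1..N. f (real (enumerate S (n - 1)) * x)) / of_nat N)
         \<longlonglongrightarrow> integral\<^sup>L haar_circle f}"

definition orlicz_fun :: "real \<Rightarrow> real \<Rightarrow> real" where
  "orlicz_fun \<beta> x = x * ln (1 + x) powr \<beta>"

text \<open>The integral is that of a nonnegative measurable function, so it is taken in \<open>[0,\<infinity>]\<close>.\<close>

definition orlicz_space :: "(real \<Rightarrow> real) \<Rightarrow> (real \<Rightarrow> complex) set" where
  "orlicz_space \<phi> = {f. circle_fun f \<and> f \<in> borel_measurable haar_circle \<and>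
     (\<exists>a>0. (\<integral>\<^sup>+ x. ennreal (\<phi> (norm (f x) / a)) \<partial>haar_circle) < \<infinity>)}"

definition random_set :: "(nat \<Rightarrow> 'w \<Rightarrow> nat) \<Rightarrow> 'w \<Rightarrow> nat set" where
  "random_set \<xi> \<omega> = {k. 1 \<le> k \<and> \<xi> k \<omega> = 1}"

end

theory Submission
  imports Defs
begin

text \<open>
  Put \<open>B\<^sub>N = 1 + \<delta>\<^sub>1 + \<dots> + \<delta>\<^sub>N\<close>. By Fubini it suffices to fix a generic point \<open>x\<close> and to show that,
  almost surely, the sum of \<open>\<xi>\<^sub>k f(k x)\<close> over \<open>k \<le> N\<close>, divided by \<open>B\<^sub>N\<close>, tends to \<open>\<integral> f\<close>. As \<open>\<delta>\<close> is
  non-increasing, summation by parts gives this with \<open>\<delta>\<^sub>k\<close> in place of \<open>\<xi>\<^sub>k\<close>. For the difference,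
  Kronecker's lemma asks for the convergence of the series of \<open>(\<xi>\<^sub>k - \<delta>\<^sub>k) f(k x) / B\<^sub>k\<close>. Splitting its
  coefficients at size 1, Kolmogorov's theorem on independent centred variables handles the small
  ones and absolute convergence the large ones, as soon as the series of
  \<open>\<delta>\<^sub>k \<psi>(|f(k x)| / B\<^sub>k)\<close> converges, where \<open>\<psi>(u) = u\<^sup>2 / (1 + u)\<close>. Since \<open>x \<mapsto> k x\<close> preserves
  Haar measure and the series of \<open>\<delta>\<^sub>k \<psi>(t / B\<^sub>k)\<close> is at most \<open>t ln (1 + t)\<close>, the integral of that series over
  the circle is at most \<open>\<integral> |f| ln (1 + |f|)\<close>, which is finite by the Orlicz hypothesis.
\<close>

section \<open>Weighted averages\<close>

text \<open>The constant may depend on \<open>\<epsilon>\<close>: as \<open>B\<close> tends to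
  infinity, \<open>C\<close> is eventually below \<open>\<epsilon> * B N\<close>. Toeplitz sums and
  weighted averages are both brought to this form.\<close>

lemma tendsto_zero_if_sublinear:
  fixes s :: "nat \<Rightarrow> 'a::real_normed_vector" and B :: "nat \<Rightarrow> real"
  assumes B: "filterlim B at_top sequentially"
    and bound: "\<And>\<epsilon>. \<epsilon> > 0 \<Longrightarrow> \<exists>C. \<forall>N. norm (s N) \<le> C + \<epsilon> * B N"
  shows "(\<lambda>N. s N /\<^sub>R B N) \<longlonglongrightarrow> 0"
proof (rule tendstoI)
  fix e :: real assume "e > 0"
  then obtain C where C: "\<And>N. norm (s N) \<le> C + e / 2 * B N"
    using bound[of "e / 2"] by auto
  have "eventually (\<lambda>N. B N > max 0 (2 * C / e)) sequentially"
    using B unfolding filterlim_at_top_dense by blast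
  then show "eventually (\<lambda>N. dist (s N /\<^sub>R B N) 0 < e) sequentially"
  proof eventually_elim
    case (elim N)
    then have "B N > 0" "C < e / 2 * B N"
      using \<open>e > 0\<close> by (auto simp: field_simps)
    then have "norm (s N) < e * B N" using C[of N] by linarith
    then show ?case using \<open>B N > 0\<close> by (simp add: field_simps)
  qed
qed

text \<open>The weights are non-negative and telescope to \<open>B N - B 0\<close>. The finitely
  many terms before \<open>r\<close> becomes small give the constant, the others at most
  \<open>e\<close> times the total weight.\<close>

lemma toeplitz_null:
  fixes r :: "nat \<Rightarrow> 'a::real_normed_vector" and B :: "nat \<Rightarrow> real"
  assumes B: "mono B" "B 0 \<ge> 0" "filterlim B at_top sequentially" and r: "r \<longlonglongrightarrow> 0"
  shows "(\<lambda>N. (\<Sum>k<N. (B (Suc k) - B k) *\<^sub>R r k) /\<^sub>R B N) \<longlonglongrightarrow> 0"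
proof (rule tendsto_zero_if_sublinear[OF B(3)])
  fix e :: real assume e: "e > 0"
  then obtain K where K: "\<And>k. k \<ge> K \<Longrightarrow> norm (r k) \<le> e"
    using r by (auto simp: LIMSEQ_iff) (meson less_imp_le)
  have inc: "B k \<le> B (Suc k)" for k using B(1) by (simp add: monoD)
  define C where "C = (\<Sum>k<K. (B (Suc k) - B k) * norm (r k))"
  have "norm (\<Sum>k<N. (B (Suc k) - B k) *\<^sub>R r k) \<le> C + e * (B N - B 0)" for N
  proof -
    have "norm (\<Sum>k<N. (B (Suc k) - B k) *\<^sub>R r k) \<le> (\<Sum>k<N. (B (Suc k) - B k) * norm (r k))"
      using inc by (intro order.trans[OF norm_sum] sum_mono) simp
    \<comment> \<open>Charging \<open>e\<close> times the weight to the first \<open>K\<close> terms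
      as well lets the second part telescope over the full range.\<close>
    also have "\<dots> \<le> (\<Sum>k<N. (if k < K then (B (Suc k) - B k) * norm (r k) else 0)
                        + e * (B (Suc k) - B k))"
      using inc K e by (intro sum_mono) (auto simp: mult.commute[of e] intro!: mult_left_mono)
    also have "\<dots> = (\<Sum>k<N. if k < K then (B (Suc k) - B k) * norm (r k) else 0) + e * (B N - B 0)"
      by (simp add: sum.distrib sum_lessThan_telescope flip: sum_distrib_left)
    also have "(\<Sum>k<N. if k < K then (B (Suc k) - B k) * norm (r k) else 0)
        = (\<Sum>k\<in>{..<N} \<inter> {..<K}. (B (Suc k) - B k) * norm (r k))"
      by (simp add: sum.If_cases lessThan_def)
    also have "\<dots> \<le> C"
      unfolding C_def using inc by (intro sum_mono2) auto
    finally show ?thesis by simp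
  qed
  moreover have "C + e * (B N - B 0) \<le> C + e * B N" for N using e B(2) by simp
  ultimately show "\<exists>C. \<forall>N. norm (\<Sum>k<N. (B (Suc k) - B k) *\<^sub>R r k) \<le> C + e * B N"
    by (meson order.trans)
qed

text \<open>Abel summation with the tails \<open>r\<close> of the series: since
  \<open>y k = r k - r (Suc k)\<close>, the sum becomes a Toeplitz sum of \<open>r\<close> plus
  boundary terms that vanish after division by \<open>B N\<close>.\<close>

lemma kronecker_lemma:
  fixes y :: "nat \<Rightarrow> 'a::real_normed_vector" and B :: "nat \<Rightarrow> real"
  assumes B: "mono B" "B 0 \<ge> 0" "filterlim B at_top sequentially" and y: "summable y"
  shows "(\<lambda>N. (\<Sum>k<N. B (Suc k) *\<^sub>R y k) /\<^sub>R B N) \<longlonglongrightarrow> 0"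
proof -
  define r where "r k = suminf y - (\<Sum>i<k. y i)" for k
  have r: "r \<longlonglongrightarrow> 0"
    unfolding r_def using tendsto_diff[OF tendsto_const summable_LIMSEQ[OF y], of "suminf y"] by simp
  have eq: "(\<Sum>k<N. B (Suc k) *\<^sub>R y k)
      = (\<Sum>k<N. (B (Suc k) - B k) *\<^sub>R r k) + B 0 *\<^sub>R r 0 - B N *\<^sub>R r N" for N
    by (induction N) (simp_all add: r_def algebra_simps)
  have "eventually (\<lambda>N. B N > 0) sequentially"
    using B(3) by (auto simp: filterlim_at_top_dense)
  then have "eventually (\<lambda>N. (\<Sum>k<N. (B (Suc k) - B k) *\<^sub>R r k) /\<^sub>R B N + (B 0 *\<^sub>R r 0) /\<^sub>R B N - r N
      = (\<Sum>k<N. B (Suc k) *\<^sub>R y k) /\<^sub>R B N) sequentially"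
    by eventually_elim (simp add: eq algebra_simps)
  moreover have "(\<lambda>N. (\<Sum>k<N. (B (Suc k) - B k) *\<^sub>R r k) /\<^sub>R B N + (B 0 *\<^sub>R r 0) /\<^sub>R B N - r N)
      \<longlonglongrightarrow> 0 + 0 *\<^sub>R (B 0 *\<^sub>R r 0) - 0"
    by (intro tendsto_intros toeplitz_null[OF B r] r tendsto_inverse_0_at_top B(3))
  ultimately show ?thesis
    by (simp add: filterlim_cong)
qed

lemma summation_by_parts:
  fixes D :: "nat \<Rightarrow> 'a::real_vector" and d :: "nat \<Rightarrow> real"
  shows "(\<Sum>k<N. d k *\<^sub>R (D (Suc k) - D k))
    = d N *\<^sub>R D N - d 0 *\<^sub>R D 0 + (\<Sum>k<N. (d k - d (Suc k)) *\<^sub>R D (Suc k))"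
  by (induction N) (simp_all add: algebra_simps)

text \<open>Summation by parts in the partial sums \<open>D\<close> of \<open>c - L\<close>, which
  are \<open>o(N)\<close>. Monotonicity of \<open>d\<close> makes the new coefficients non-negative,
  so a bound on \<open>norm (D n)\<close> can be inserted termwise.\<close>

lemma weighted_average_tendsto:
  fixes c :: "nat \<Rightarrow> 'a::real_normed_vector" and d :: "nat \<Rightarrow> real"
  assumes d: "antimono d" "\<And>k. d k \<ge> 0" and B: "filterlim B at_top sequentially"
    and B_def: "B = (\<lambda>N. 1 + (\<Sum>k<N. d k))"
    and c: "(\<lambda>N. (\<Sum>k<N. c k) /\<^sub>R real N) \<longlonglongrightarrow> L"
  shows "(\<lambda>N. (\<Sum>k<N. d k *\<^sub>R c k) /\<^sub>R B N) \<longlonglongrightarrow> L"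
proof -
  define D where "D N = (\<Sum>k<N. c k - L)" for N
  have Bpos: "B N > 0" for N using d(2) by (simp add: B_def add_pos_nonneg sum_nonneg)
  have "(\<lambda>N. (\<Sum>k<N. c k) /\<^sub>R real N - L) \<longlonglongrightarrow> 0"
    using c by (simp add: LIM_zero)
  moreover have "eventually (\<lambda>N. (\<Sum>k<N. c k) /\<^sub>R real N - L = D N /\<^sub>R real N) sequentially"
    using eventually_gt_at_top[of 0]
    by eventually_elim (simp add: D_def sum_subtractf scaleR_diff_right sum_constant_scaleR)
  ultimately have D: "(\<lambda>N. D N /\<^sub>R real N) \<longlonglongrightarrow> 0"
    using filterlim_cong by fast
  have "(\<lambda>N. (\<Sum>k<N. d k *\<^sub>R (c k - L)) /\<^sub>R B N) \<longlonglongrightarrow> 0"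
  proof (rule tendsto_zero_if_sublinear[OF B])
    fix e :: real assume e: "e > 0"
    then obtain N0 where N0: "\<And>N. N \<ge> N0 \<Longrightarrow> norm (D N /\<^sub>R real N) < e"
      using D by (auto simp: LIMSEQ_iff)
    \<comment> \<open>\<open>K\<close> absorbs all indices up to \<open>N0\<close>, in particular 0,
      so that the tail estimate may divide by \<open>n\<close>.\<close>
    define K where "K = (\<Sum>n<Suc N0. norm (D n))"
    have DK: "norm (D n) \<le> K + e * n" for n
    proof (cases "n < Suc N0")
      case True
      then have "norm (D n) \<le> K" unfolding K_def by (intro member_le_sum) auto
      then show ?thesis using e by (simp add: add_increasing2)
    next
      case False
      then have "norm (D n) \<le> e * n" using N0[of n] by (simp add: field_simps)
      moreover have "K \<ge> 0" by (simp add: K_def sum_nonneg)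
      ultimately show ?thesis by simp
    qed
    have dec: "d (Suc k) \<le> d k" for k using d(1) by (simp add: antimonoD)
    have "norm (\<Sum>k<N. d k *\<^sub>R (c k - L)) \<le> d 0 * K + e * (\<Sum>k<N. d k)" for N
    proof -
      have "(\<Sum>k<N. d k *\<^sub>R (c k - L)) = (\<Sum>k<N. d k *\<^sub>R (D (Suc k) - D k))"
        by (simp add: D_def)
      also have "\<dots> = d N *\<^sub>R D N + (\<Sum>k<N. (d k - d (Suc k)) *\<^sub>R D (Suc k))"
        unfolding summation_by_parts by (simp add: D_def)
      also have "norm \<dots> \<le> d N * norm (D N) + (\<Sum>k<N. (d k - d (Suc k)) * norm (D (Suc k)))"
        using d(2) dec by (intro norm_triangle_le add_mono order.trans[OF norm_sum] sum_mono) simp_all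
      also have "\<dots> \<le> d N * (K + e * N) + (\<Sum>k<N. (d k - d (Suc k)) * (K + e * Suc k))"
        using d(2) dec by (intro add_mono sum_mono mult_left_mono DK) simp_all
      \<comment> \<open>Summation by parts is undone for the linear majorant
        \<open>K + e * k\<close>, whose increments are all \<open>e\<close>.\<close>
      also have "\<dots> = d 0 * K + (\<Sum>k<N. d k *\<^sub>R ((K + e * Suc k) - (K + e * k)))"
        by (subst summation_by_parts[of d "\<lambda>k. K + e * real k"]) (simp add: algebra_simps)
      also have "\<dots> = d 0 * K + e * (\<Sum>k<N. d k)"
        by (simp add: algebra_simps sum_distrib_left)
      finally show ?thesis .
    qed
    moreover have "d 0 * K + e * (\<Sum>k<N. d k) \<le> d 0 * K + e * B N" for N
      using e by (simp add: B_def)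
    ultimately show "\<exists>C. \<forall>N. norm (\<Sum>k<N. d k *\<^sub>R (c k - L)) \<le> C + e * B N"
      by (meson order.trans)
  qed
  \<comment> \<open>The total weight is \<open>B N - 1\<close>, so undoing the centring adds
    \<open>(1 - inverse (B N)) *\<^sub>R L\<close>.\<close>
  moreover have "(\<lambda>N. (1 - inverse (B N)) *\<^sub>R L) \<longlonglongrightarrow> (1 - 0) *\<^sub>R L"
    by (intro tendsto_intros tendsto_inverse_0_at_top B)
  ultimately have "(\<lambda>N. (\<Sum>k<N. d k *\<^sub>R (c k - L)) /\<^sub>R B N + (1 - inverse (B N)) *\<^sub>R L) \<longlonglongrightarrow> 0 + (1 - 0) *\<^sub>R L"
    by (rule tendsto_add)
  moreover have "(\<Sum>k<N. d k *\<^sub>R (c k - L)) /\<^sub>R B N + (1 - inverse (B N)) *\<^sub>R L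
      = (\<Sum>k<N. d k *\<^sub>R c k) /\<^sub>R B N" for N
  proof -
    have *: "(\<Sum>k<N. d k) = B N - 1" by (simp add: B_def)
    have "(1 - inverse (B N)) *\<^sub>R L = ((B N - 1) *\<^sub>R L) /\<^sub>R B N"
      using Bpos[of N] by (simp add: algebra_simps)
    moreover have "(\<Sum>k<N. d k *\<^sub>R (c k - L)) = (\<Sum>k<N. d k *\<^sub>R c k) - (B N - 1) *\<^sub>R L"
      by (simp add: scaleR_diff_right sum_subtractf * flip: scaleR_sum_left)
    ultimately show ?thesis by (simp add: scaleR_diff_right)
  qed
  ultimately show ?thesis by simp
qed

text \<open>
  With \<open>F s = ln (s / (s + t))\<close> one has \<open>t / (s (s + t)) = F' s\<close>, and this is decreasing in \<open>s\<close>;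
  the sum is thus a lower sum for \<open>t * F'\<close> on \<open>[1, \<infinity>)\<close>.
\<close>
lemma sum_weighted_le_mult_ln:
  fixes d :: "nat \<Rightarrow> real" and t :: real
  assumes d: "\<And>k. d k \<ge> 0" and B_def: "B = (\<lambda>N. 1 + (\<Sum>k<N. d k))" and t: "t \<ge> 0"
  shows "(\<Sum>k<N. d k * ((t / B (Suc k))\<^sup>2 / (1 + t / B (Suc k)))) \<le> t * ln (1 + t)"
proof -
  define F where "F s = ln (s / (s + t))" for s :: real
  have Bge: "B k \<ge> 1" for k using d by (simp add: B_def sum_nonneg)
  have step: "d k * ((t / B (Suc k))\<^sup>2 / (1 + t / B (Suc k))) \<le> t * (F (B (Suc k)) - F (B k))" for k
  proof -
    define a b where "a = B k" and "b = B (Suc k)"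
    have ab: "a \<ge> 1" "a \<le> b" "d k = b - a" using Bge[of k] d[of k] by (simp_all add: a_def b_def B_def)
    \<comment> \<open>\<open>?q\<close> is the exponential of \<open>F a - F b\<close>, so
      \<open>ln ?q \<le> ?q - 1\<close> bounds the increment of \<open>F\<close> from below without
      derivatives. The denominator \<open>b * (a + t)\<close> obtained is then enlarged to
      \<open>b * (b + t)\<close>.\<close>
    let ?q = "(a / (a + t)) / (b / (b + t))"
    have q: "?q > 0" using ab t by simp
    have "F b - F a = - ln ?q"
      unfolding F_def using ab t by (simp add: ln_div ln_mult)
    also have "\<dots> \<ge> 1 - ?q" using ln_le_minus_one[OF q] by linarith
    also have "1 - ?q = t * (b - a) / (b * (a + t))"
      using ab t by (simp add: divide_simps) (simp add: algebra_simps)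
    finally have "t * (b - a) / (b * (a + t)) \<le> F b - F a" .
    moreover have "t * (b - a) / (b * (b + t)) \<le> t * (b - a) / (b * (a + t))"
      using ab t by (intro divide_left_mono mult_left_mono mult_nonneg_nonneg mult_pos_pos) auto
    ultimately have "t * (t * (b - a) / (b * (b + t))) \<le> t * (F b - F a)"
      using t by (intro mult_left_mono) auto
    moreover have "(b - a) * ((t / b)\<^sup>2 / (1 + t / b)) = t * (t * (b - a) / (b * (b + t)))"
      using ab t by (simp add: divide_simps power2_eq_square)
    ultimately show ?thesis using ab by (simp add: a_def b_def)
  qed
  have "(\<Sum>k<N. d k * ((t / B (Suc k))\<^sup>2 / (1 + t / B (Suc k)))) \<le> (\<Sum>k<N. t * (F (B (Suc k)) - F (B k)))"
    by (intro sum_mono step)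
  also have "\<dots> = t * (F (B N) - F (B 0))"
    using sum_lessThan_telescope[of "\<lambda>k. F (B k)" N] by (simp flip: sum_distrib_left)
  also have "\<dots> \<le> t * ln (1 + t)"
  proof (intro mult_left_mono t)
    have "F (B N) \<le> 0" unfolding F_def using Bge[of N] t by (subst ln_le_zero_iff) (auto simp: field_simps)
    moreover have "F (B 0) = - ln (1 + t)" using t by (simp add: F_def B_def ln_div)
    ultimately show "F (B N) - F (B 0) \<le> ln (1 + t)" by simp
  qed
  finally show ?thesis .
qed

text \<open>With \<open>t = a * u\<close> one has \<open>1 + t \<le> (1 + a) * (1 + u)\<close>, and
  \<open>v = ln (1 + u)\<close> is at most \<open>1 + v powr \<beta>\<close>. Hence integrability of
  \<open>f\<close> and the Orlicz condition together control the integral of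
  \<open>t * ln (1 + t)\<close> at \<open>t = norm (f x)\<close>.\<close>

lemma mult_ln_le_orlicz_fun:
  assumes "\<beta> \<ge> 1" "a > 0" "t \<ge> 0"
  shows "t * ln (1 + t) \<le> (1 + ln (1 + a)) * t + a * orlicz_fun \<beta> (t / a)"
proof -
  define u where "u = t / a"
  have u: "u \<ge> 0" "t = a * u" using assms by (auto simp: u_def)
  define v where "v = ln (1 + u)"
  have v: "v \<ge> 0" using u by (simp add: v_def)
  have "v \<le> 1 + v powr \<beta>"
  proof (cases "v \<le> 1")
    case False
    then have "v powr 1 \<le> v powr \<beta>" using assms by (intro powr_mono) auto
    then show ?thesis using False by simp
  qed (simp add: add_increasing2)
  have "ln (1 + t) \<le> ln ((1 + a) * (1 + u))"
    using u assms by (subst ln_le_cancel_iff) (auto simp: algebra_simps intro: add_pos_nonneg)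
  also have "\<dots> = ln (1 + a) + v" using u assms by (simp add: ln_mult v_def)
  also have "\<dots> \<le> (1 + ln (1 + a)) + v powr \<beta>" using \<open>v \<le> 1 + v powr \<beta>\<close> by simp
  finally have "t * ln (1 + t) \<le> t * ((1 + ln (1 + a)) + v powr \<beta>)"
    using assms by (intro mult_left_mono)
  also have "\<dots> = (1 + ln (1 + a)) * t + a * (u * v powr \<beta>)"
    using u by (simp add: algebra_simps)
  finally show ?thesis by (simp add: orlicz_fun_def u_def v_def)
qed

section \<open>Random series\<close>

text \<open>\<open>H k\<close> sees only variables before \<open>k\<close>, so it is independent of
  \<open>X k\<close>: the mixed terms have mean 0, and as \<open>H\<close> is bounded by 1 no second
  moment grows. This is the orthogonality of martingale differences, phrased without conditional
  expectations.\<close>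

lemma (in prob_space) stopped_sum_second_moment:
  fixes X :: "nat \<Rightarrow> 'a \<Rightarrow> real" and h :: "nat \<Rightarrow> (nat \<Rightarrow> real) \<Rightarrow> real"
  assumes ind: "indep_vars (\<lambda>_. borel) X UNIV"
    and sq: "\<And>k. integrable M (\<lambda>\<omega>. (X k \<omega>)\<^sup>2)"
    and mean: "\<And>k. expectation (X k) = 0"
    and h [measurable]: "\<And>k. h k \<in> borel_measurable (PiM {m..<k} (\<lambda>_. borel))"
    and h_bound: "\<And>k y. \<bar>h k y\<bar> \<le> 1"
  defines "H \<equiv> \<lambda>k \<omega>. h k (restrict (\<lambda>i. X i \<omega>) {m..<k})"
  defines "Z \<equiv> \<lambda>n \<omega>. \<Sum>k=m..<n. H k \<omega> * X k \<omega>"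
  shows "integrable M (\<lambda>\<omega>. (Z n \<omega>)\<^sup>2)"
    and "expectation (\<lambda>\<omega>. (Z n \<omega>)\<^sup>2) \<le> (\<Sum>k=m..<n. expectation (\<lambda>\<omega>. (X k \<omega>)\<^sup>2))"
proof -
  have X[measurable]: "random_variable borel (X k)" for k using ind by (auto simp: indep_vars_def)
  have H[measurable]: "random_variable borel (H k)" for k
    unfolding H_def by (rule measurable_compose[OF _ h]) measurable
  have Z[measurable]: "random_variable borel (Z k)" for k unfolding Z_def by measurable
  have X_int: "integrable M (X k)" for k by (rule square_integrable_imp_integrable[OF X sq])
  have H_bound: "\<bar>H k \<omega>\<bar> \<le> 1" for k \<omega> by (simp add: H_def h_bound)
  have HX_sq: "(H k \<omega> * X k \<omega>)\<^sup>2 \<le> (X k \<omega>)\<^sup>2" for k \<omega>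
  proof -
    have "(H k \<omega>)\<^sup>2 \<le> 1" using H_bound by (simp add: abs_square_le_1)
    then show ?thesis by (simp add: power_mult_distrib mult_left_le_one_le)
  qed
  have HX_int: "integrable M (\<lambda>\<omega>. (H k \<omega> * X k \<omega>)\<^sup>2)" for k
    by (rule Bochner_Integration.integrable_bound[OF sq[of k]]) (use HX_sq in auto)
  \<comment> \<open>The premise on \<open>Z n\<close> comes from the induction below; it makes
    \<open>Z n * H n\<close> integrable, as the product rule for independent variables
    demands.\<close>
  have cross: "integrable M (\<lambda>\<omega>. Z n \<omega> * H n \<omega> * X n \<omega>) \<and> expectation (\<lambda>\<omega>. Z n \<omega> * H n \<omega> * X n \<omega>) = 0"
    if Zsq: "integrable M (\<lambda>\<omega>. (Z n \<omega>)\<^sup>2)" for n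
  proof -
    \<comment> \<open>\<open>G\<close> exhibits \<open>Z n * H n\<close> as a function of the
      coordinates in \<open>{m..<n}\<close>, a set disjoint from \<open>{n}\<close>.\<close>
    define G where "G y = (\<Sum>k=m..<n. h k (restrict y {m..<k}) * y k) * h n y" for y :: "nat \<Rightarrow> real"
    have G: "G \<in> borel_measurable (PiM {m..<n} (\<lambda>_. borel))"
    proof -
      have [measurable]: "(\<lambda>y. h k (restrict y {m..<k})) \<in> borel_measurable (PiM {m..<n} (\<lambda>_. borel))"
        if "k \<in> {m..<n}" for k
        using that by (intro measurable_compose[OF measurable_restrict_subset h]) auto
      show ?thesis unfolding G_def by measurable
    qed
    have GZ: "Z n \<omega> * H n \<omega> = G (restrict (\<lambda>i. X i \<omega>) {m..<n})" for \<omega>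
      unfolding G_def Z_def H_def
      by (intro arg_cong2[where f="(*)"] sum.cong refl arg_cong[where f="h _"])
         (auto simp: restrict_def fun_eq_iff)
    have "indep_var (PiM {m..<n} (\<lambda>_. borel)) (\<lambda>\<omega>. restrict (\<lambda>i. X i \<omega>) {m..<n})
        (PiM {n} (\<lambda>_. borel)) (\<lambda>\<omega>. restrict (\<lambda>i. X i \<omega>) {n})"
      by (rule indep_var_restrict[OF ind]) auto
    then have "indep_var borel (G \<circ> (\<lambda>\<omega>. restrict (\<lambda>i. X i \<omega>) {m..<n})) borel ((\<lambda>y. y n) \<circ> (\<lambda>\<omega>. restrict (\<lambda>i. X i \<omega>) {n}))"
      by (rule indep_var_compose[OF _ G]) simp
    then have iv: "indep_var borel (\<lambda>\<omega>. Z n \<omega> * H n \<omega>) borel (X n)"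
      by (simp add: comp_def GZ)
    have ZH: "integrable M (\<lambda>\<omega>. Z n \<omega> * H n \<omega>)"
      by (rule Bochner_Integration.integrable_bound[OF square_integrable_imp_integrable[OF Z Zsq]])
         (use H_bound in \<open>auto simp: abs_mult mult_left_le\<close>)
    show ?thesis
      using indep_var_integrable[OF iv ZH X_int] indep_var_lebesgue_integral[OF iv ZH X_int] mean by simp
  qed
  have "integrable M (\<lambda>\<omega>. (Z n \<omega>)\<^sup>2) \<and>
    expectation (\<lambda>\<omega>. (Z n \<omega>)\<^sup>2) \<le> (\<Sum>k=m..<n. expectation (\<lambda>\<omega>. (X k \<omega>)\<^sup>2))" for n
  proof (induction n)
    case 0
    then show ?case by (simp add: Z_def)
  next
    case (Suc n)
    show ?case
    proof (cases "m \<le> n")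
      case True
      have sq_eq: "(Z (Suc n) \<omega>)\<^sup>2 = (Z n \<omega>)\<^sup>2 + 2 * (Z n \<omega> * H n \<omega> * X n \<omega>) + (H n \<omega> * X n \<omega>)\<^sup>2" for \<omega>
        using True by (simp add: Z_def power2_sum algebra_simps)
      have Zn: "integrable M (\<lambda>\<omega>. (Z n \<omega>)\<^sup>2)" using Suc by simp
      note cr = cross[OF Zn]
      have "expectation (\<lambda>\<omega>. (H n \<omega> * X n \<omega>)\<^sup>2) \<le> expectation (\<lambda>\<omega>. (X n \<omega>)\<^sup>2)"
        by (intro integral_mono HX_int sq HX_sq)
      then show ?thesis
        using Suc True cr HX_int[of n] by (simp add: sq_eq)
    qed (use Suc in \<open>simp add: Z_def\<close>)
  qed
  then show "integrable M (\<lambda>\<omega>. (Z n \<omega>)\<^sup>2)"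
    and "expectation (\<lambda>\<omega>. (Z n \<omega>)\<^sup>2) \<le> (\<Sum>k=m..<n. expectation (\<lambda>\<omega>. (X k \<omega>)\<^sup>2))"
    by auto
qed

text \<open>
  Stop the partial sums as soon as they leave \<open>(-e, e)\<close>: the stopped sum keeps absolute value at
  least \<open>e\<close> from then on, so Markov's inequality for its second moment suffices.
\<close>
lemma (in prob_space) kolmogorov_maximal_inequality:
  fixes X :: "nat \<Rightarrow> 'a \<Rightarrow> real"
  assumes ind: "indep_vars (\<lambda>_. borel) X UNIV"
    and sq: "\<And>k. integrable M (\<lambda>\<omega>. (X k \<omega>)\<^sup>2)"
    and mean: "\<And>k. expectation (X k) = 0"
    and e: "e > 0"
  shows "prob {\<omega> \<in> space M. \<exists>j\<in>{m..n}. \<bar>\<Sum>i=m..<j. X i \<omega>\<bar> \<ge> e}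
    \<le> (\<Sum>k=m..<n. expectation (\<lambda>\<omega>. (X k \<omega>)\<^sup>2)) / e\<^sup>2"
proof -
  have X[measurable]: "random_variable borel (X k)" for k using ind by (auto simp: indep_vars_def)
  \<comment> \<open>The indicator of no exit so far. Sums over \<open>m..<j\<close> with
    \<open>j \<le> k\<close> involve only indices below \<open>k\<close>, so whether
    \<open>X k\<close> is added is decided before \<open>X k\<close> is seen.\<close>
  define h :: "nat \<Rightarrow> (nat \<Rightarrow> real) \<Rightarrow> real"
    where "h k y = (if \<forall>j\<in>{m..k}. \<bar>\<Sum>i=m..<j. y i\<bar> < e then 1 else 0)" for k y
  define H where "H k \<omega> = h k (restrict (\<lambda>i. X i \<omega>) {m..<k})" for k \<omega>
  define Z where "Z n \<omega> = (\<Sum>k=m..<n. H k \<omega> * X k \<omega>)" for n \<omega>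
  have hm: "h k \<in> borel_measurable (PiM {m..<k} (\<lambda>_. borel))" for k
  proof -
    have "(\<lambda>y. \<Sum>i=m..<j. y i) \<in> borel_measurable (PiM {m..<k} (\<lambda>_. borel::real measure))" if "j \<in> {m..k}" for j
      using that by (intro borel_measurable_sum measurable_component_singleton) auto
    then show ?thesis unfolding h_def by measurable
  qed
  have hb: "\<bar>h k y\<bar> \<le> 1" for k y by (simp add: h_def)
  note Z = stopped_sum_second_moment[OF ind sq mean hm hb, of n, folded H_def, folded Z_def]
  have H_eq: "H k \<omega> = (if \<forall>j\<in>{m..k}. \<bar>\<Sum>i=m..<j. X i \<omega>\<bar> < e then 1 else 0)" for k \<omega>
    unfolding H_def h_def by (intro if_cong ball_cong refl arg_cong2[where f="(<)"] arg_cong[where f=abs] sum.cong) auto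
  have stop: "\<bar>Z n \<omega>\<bar> \<ge> e" if ex: "\<exists>j\<in>{m..n}. \<bar>\<Sum>i=m..<j. X i \<omega>\<bar> \<ge> e" for \<omega>
  proof -
    \<comment> \<open>\<open>j\<close> is the first exit: exactly the terms with index below
      \<open>j\<close> survive, so \<open>Z n\<close> is frozen at the value that left the
      interval.\<close>
    define j where "j = (LEAST j. j \<in> {m..n} \<and> \<bar>\<Sum>i=m..<j. X i \<omega>\<bar> \<ge> e)"
    have "\<exists>j. j \<in> {m..n} \<and> \<bar>\<Sum>i=m..<j. X i \<omega>\<bar> \<ge> e" using ex by blast
    from LeastI_ex[OF this] have j: "j \<in> {m..n}" "\<bar>\<Sum>i=m..<j. X i \<omega>\<bar> \<ge> e"
      unfolding j_def by blast+
    have less: "\<bar>\<Sum>i=m..<i'. X i \<omega>\<bar> < e" if "i' \<in> {m..<j}" for i'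
      using not_less_Least[of i' "\<lambda>j. j \<in> {m..n} \<and> \<bar>\<Sum>i=m..<j. X i \<omega>\<bar> \<ge> e", folded j_def]
        that j(1) by auto
    have "Z n \<omega> = (\<Sum>k\<in>{m..<n}. if k < j then X k \<omega> else 0)"
      unfolding Z_def
    proof (intro sum.cong refl)
      fix k assume k: "k \<in> {m..<n}"
      show "H k \<omega> * X k \<omega> = (if k < j then X k \<omega> else 0)"
      proof (cases "k < j")
        case True then show ?thesis using less by (auto simp: H_eq)
      next
        case False
        then have "\<not> (\<forall>j\<in>{m..k}. \<bar>\<Sum>i=m..<j. X i \<omega>\<bar> < e)" using j by (auto intro!: bexI[of _ j])
        then have "H k \<omega> = 0" unfolding H_eq by (rule if_not_P)
        then show ?thesis using False by simp
      qed
    qed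
    also have "\<dots> = (\<Sum>k\<in>{m..<j}. X k \<omega>)"
      using j(1) by (intro sum.mono_neutral_cong_right) auto
    finally show ?thesis using j by simp
  qed
  have Zm[measurable]: "random_variable borel (Z n)"
    unfolding Z_def H_eq by measurable
  have "prob {\<omega> \<in> space M. \<exists>j\<in>{m..n}. \<bar>\<Sum>i=m..<j. X i \<omega>\<bar> \<ge> e} \<le> prob {\<omega> \<in> space M. (Z n \<omega>)\<^sup>2 \<ge> e\<^sup>2}"
    using stop e by (intro finite_measure_mono) (auto simp: abs_le_square_iff[symmetric])
  also have "\<dots> \<le> expectation (\<lambda>\<omega>. (Z n \<omega>)\<^sup>2) / e\<^sup>2"
    using e by (intro integral_Markov_inequality_measure[where A="{}"] Z) auto
  also have "\<dots> \<le> (\<Sum>k=m..<n. expectation (\<lambda>\<omega>. (X k \<omega>)\<^sup>2)) / e\<^sup>2"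
    by (intro divide_right_mono Z) simp
  finally show ?thesis .
qed

text \<open>The maximal inequality bounds the probability that the partial sums move by
  \<open>e\<close> after time \<open>m\<close> by a tail of the variance series. Letting
  \<open>m\<close> grow, the partial sums are almost surely Cauchy.\<close>

lemma (in prob_space) kolmogorov_convergence:
  fixes X :: "nat \<Rightarrow> 'a \<Rightarrow> real"
  assumes ind: "indep_vars (\<lambda>_. borel) X UNIV"
    and sq: "\<And>k. integrable M (\<lambda>\<omega>. (X k \<omega>)\<^sup>2)"
    and mean: "\<And>k. expectation (X k) = 0"
    and var: "summable (\<lambda>k. expectation (\<lambda>\<omega>. (X k \<omega>)\<^sup>2))"
  shows "AE \<omega> in M. summable (\<lambda>k. X k \<omega>)"
proof -
  have X[measurable]: "random_variable borel (X k)" for k using ind by (auto simp: indep_vars_def)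
  let ?V = "\<lambda>k. expectation (\<lambda>\<omega>. (X k \<omega>)\<^sup>2)"
  have "AE \<omega> in M. \<exists>m. \<forall>j\<ge>m. \<bar>\<Sum>i=m..<j. X i \<omega>\<bar> < e" if e: "e > 0" for e
  proof -
    define A where "A m n = {\<omega> \<in> space M. \<exists>j\<in>{m..n}. \<bar>\<Sum>i=m..<j. X i \<omega>\<bar> \<ge> e}" for m n
    have A[measurable]: "A m n \<in> events" for m n unfolding A_def by measurable
    \<comment> \<open>On \<open>T\<close> the sums from every starting point \<open>m\<close> reach
      size \<open>e\<close>. It lies in each union over \<open>n\<close>, whose probability is the
      limit of those with finite horizon.\<close>
    define T where "T = (\<Inter>m. \<Union>n. A m n)"
    have T[measurable]: "T \<in> events" unfolding T_def by measurable
    have bound: "prob T \<le> (suminf ?V - (\<Sum>k<m. ?V k)) / e\<^sup>2" for m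
    proof -
      have "(\<lambda>n. prob (A m n)) \<longlonglongrightarrow> prob (\<Union>n. A m n)"
        by (intro finite_Lim_measure_incseq) (auto simp: incseq_def A_def intro: order.trans)
      moreover have "prob (A m n) \<le> (suminf ?V - (\<Sum>k<m. ?V k)) / e\<^sup>2" for n
      proof -
        have "prob (A m n) \<le> (\<Sum>k=m..<n. ?V k) / e\<^sup>2"
          unfolding A_def by (rule kolmogorov_maximal_inequality[OF ind sq mean e])
        also have "(\<Sum>k=m..<n. ?V k) \<le> (suminf ?V - (\<Sum>k<m. ?V k))"
        proof -
          have "(\<Sum>k<m. ?V k) + (\<Sum>k=m..<n. ?V k) = (\<Sum>k\<in>{..<m} \<union> {m..<n}. ?V k)"
            by (rule sum.union_disjoint[symmetric]) auto
          also have "\<dots> \<le> suminf ?V" by (intro sum_le_suminf var) auto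
          finally show ?thesis by simp
        qed
        finally show ?thesis by (simp add: divide_right_mono)
      qed
      ultimately have "prob (\<Union>n. A m n) \<le> (suminf ?V - (\<Sum>k<m. ?V k)) / e\<^sup>2"
        by (intro LIMSEQ_le_const2) auto
      moreover have "prob T \<le> prob (\<Union>n. A m n)"
        unfolding T_def by (intro finite_measure_mono) auto
      ultimately show ?thesis by simp
    qed
    have "(\<lambda>m. (suminf ?V - (\<Sum>k<m. ?V k)) / e\<^sup>2) \<longlonglongrightarrow> (suminf ?V - suminf ?V) / e\<^sup>2"
      using e by (intro tendsto_intros summable_LIMSEQ var) auto
    then have "prob T \<le> 0" using bound by (intro LIMSEQ_le_const) auto
    then have "T \<in> null_sets M" by (simp add: emeasure_eq_measure measure_le_0_iff null_setsI)
    then have "AE \<omega> in M. \<omega> \<notin> T" by (rule AE_not_in)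
    then show ?thesis
    proof (rule AE_mp, intro AE_I2 impI)
      fix \<omega> assume "\<omega> \<in> space M" "\<omega> \<notin> T"
      then obtain m where m: "\<And>n. \<omega> \<notin> A m n" by (auto simp: T_def)
      then show "\<exists>m. \<forall>j\<ge>m. \<bar>\<Sum>i=m..<j. X i \<omega>\<bar> < e"
        using \<open>\<omega> \<in> space M\<close> by (intro exI[of _ m]) (force simp: A_def not_le)
    qed
  qed
  \<comment> \<open>Countably many thresholds suffice. The factor 2 is spent because a block
    \<open>a..<b\<close> is a difference of two sums starting at \<open>m\<close>.\<close>
  then have "AE \<omega> in M. \<forall>q::nat. \<exists>m. \<forall>j\<ge>m. \<bar>\<Sum>i=m..<j. X i \<omega>\<bar> < 1 / (2 * Suc q)"
    by (subst AE_all_countable) auto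
  then show ?thesis
  proof (rule AE_mp, intro AE_I2 impI)
    fix \<omega> assume *: "\<forall>q::nat. \<exists>m. \<forall>j\<ge>m. \<bar>\<Sum>i=m..<j. X i \<omega>\<bar> < 1 / (2 * Suc q)"
    show "summable (\<lambda>k. X k \<omega>)"
      unfolding summable_Cauchy
    proof (intro allI impI)
      fix e :: real assume "e > 0"
      then obtain q where q: "1 / real (Suc q) < e"
        by (metis reals_Archimedean inverse_eq_divide)
      from * obtain m where m: "\<And>j. j \<ge> m \<Longrightarrow> \<bar>\<Sum>i=m..<j. X i \<omega>\<bar> < 1 / (2 * Suc q)" by blast
      have "norm (\<Sum>i=a..<b. X i \<omega>) < e" if "a \<ge> m" for a b
      proof (cases "a \<le> b")
        case True
        have "(\<Sum>i=m..<b. X i \<omega>) = (\<Sum>i=m..<a. X i \<omega>) + (\<Sum>i=a..<b. X i \<omega>)"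
          using that True by (simp add: sum.atLeastLessThan_concat)
        moreover have "1 / (2 * real (Suc q)) + 1 / (2 * real (Suc q)) = 1 / real (Suc q)"
          by (simp add: field_simps)
        ultimately show ?thesis using m[of a] m[of b] that True q by auto
      qed (use \<open>e > 0\<close> in simp)
      then show "\<exists>N. \<forall>m\<ge>N. \<forall>n. norm (sum (\<lambda>k. X k \<omega>) {m..<n}) < e" by blast
    qed
  qed
qed

section \<open>Independent Bernoulli selectors and weighted random averages\<close>

lemma (in prob_space) indep_vars_Suc:
  assumes "indep_vars (\<lambda>_. N) X {1..}"
  shows "indep_vars (\<lambda>_. N) (\<lambda>k. X (Suc k)) UNIV"
proof -
  let ?F = "\<lambda>i. {X i -` A \<inter> space M |A. A \<in> sets N}"
  have X: "random_variable N (X k)" if "k \<ge> 1" for k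
    using assms that unfolding indep_vars_def2 by auto
  have ind: "indep_sets ?F {1..}"
    using assms unfolding indep_vars_def2 by auto
  have "indep_sets (\<lambda>k. ?F (Suc k)) UNIV"
  proof (rule indep_setsI)
    show "?F (Suc k) \<subseteq> events" for k using X[of "Suc k"] by auto
    fix A J assume J: "J \<noteq> {}" "finite (J :: nat set)" and A: "\<forall>j\<in>J. A j \<in> ?F (Suc j)"
    \<comment> \<open>The events are transported along \<open>Suc\<close> to indices in
      \<open>{1..}\<close>, hence the \<open>j - 1\<close>.\<close>
    have "prob (\<Inter>j\<in>Suc ` J. A (j - 1)) = (\<Prod>j\<in>Suc ` J. prob (A (j - 1)))"
      using J A by (intro indep_setsD[OF ind]) auto
    then show "prob (\<Inter>j\<in>J. A j) = (\<Prod>j\<in>J. prob (A j))"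
      by (simp add: prod.reindex)
  qed
  then show ?thesis using X unfolding indep_vars_def2 by auto
qed

text \<open>The centred selector has variance \<open>d k * (1 - d k) \<le> d k\<close>, so the
  hypothesis on \<open>w\<close> gives the variance condition of Kolmogorov's theorem.\<close>

lemma bernoulli_random_series_L2:
  fixes \<xi> :: "nat \<Rightarrow> 'w \<Rightarrow> nat" and d w :: "nat \<Rightarrow> real"
  assumes M: "prob_space M"
    and ind: "prob_space.indep_vars M (\<lambda>_. count_space UNIV) \<xi> UNIV"
    and vals: "\<And>k \<omega>. \<omega> \<in> space M \<Longrightarrow> \<xi> k \<omega> \<in> {0, 1}"
    and p: "\<And>k. measure M {\<omega> \<in> space M. \<xi> k \<omega> = 1} = d k"
    and w: "summable (\<lambda>k. d k * (w k)\<^sup>2)"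
  shows "AE \<omega> in M. summable (\<lambda>k. (real (\<xi> k \<omega>) - d k) * w k)"
proof -
  interpret prob_space M by fact
  have [measurable]: "\<xi> k \<in> measurable M (count_space UNIV)" for k
    using ind by (auto simp: indep_vars_def)
  have [measurable]: "(\<lambda>\<omega>. real (\<xi> k \<omega>)) \<in> borel_measurable M" for k
    by (rule measurable_compose[of "\<xi> k" M "count_space UNIV" real borel]) auto
  have d: "d k \<ge> 0" for k unfolding p[symmetric] by simp
  have int: "integrable M (\<lambda>\<omega>. real (\<xi> k \<omega>))" for k
    using vals by (intro integrable_const_bound[where B=1]) (auto intro!: AE_I2 dest!: vals[of _ k])
  have E: "expectation (\<lambda>\<omega>. real (\<xi> k \<omega>)) = d k" for k
  proof -
    have "expectation (\<lambda>\<omega>. real (\<xi> k \<omega>)) = expectation (indicator {\<omega> \<in> space M. \<xi> k \<omega> = 1})"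
      using vals[of _ k] by (intro Bochner_Integration.integral_cong) (auto simp: indicator_def)
    also have "\<dots> = d k" using p[of k] by simp
    finally show ?thesis .
  qed
  let ?X = "\<lambda>k \<omega>. (real (\<xi> k \<omega>) - d k) * w k"
  \<comment> \<open>As \<open>\<xi> k\<close> is 0 or 1, it equals its square; the left side is thus
    affine in \<open>\<xi> k\<close>, and its mean follows from that of
    \<open>\<xi> k\<close>.\<close>
  have sq: "(?X k \<omega>)\<^sup>2 = (real (\<xi> k \<omega>) * (1 - 2 * d k) + (d k)\<^sup>2) * (w k)\<^sup>2" if "\<omega> \<in> space M" for k \<omega>
    using vals[OF that, of k] by (auto simp: power2_eq_square algebra_simps)
  have int_sq: "integrable M (\<lambda>\<omega>. (?X k \<omega>)\<^sup>2)" for k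
    by (subst Bochner_Integration.integrable_cong[OF refl sq]) (use int in auto)
  have E_sq: "expectation (\<lambda>\<omega>. (?X k \<omega>)\<^sup>2) = (d k * (1 - d k)) * (w k)\<^sup>2" for k
    by (subst Bochner_Integration.integral_cong[OF refl sq])
       (use int in \<open>auto simp: E prob_space power2_eq_square algebra_simps\<close>)
  show ?thesis
  proof (rule kolmogorov_convergence)
    show "indep_vars (\<lambda>_. borel) ?X UNIV"
      by (rule indep_vars_compose2[OF ind, where Y="\<lambda>k n. (real n - d k) * w k"]) simp
    show "expectation (?X k) = 0" for k
      using int by (simp add: E prob_space)
    show "summable (\<lambda>k. expectation (\<lambda>\<omega>. (?X k \<omega>)\<^sup>2))"
    proof (rule summable_comparison_test'[OF w, of 0])
      fix k
      have "0 \<le> d k * (1 - d k)" "d k * (1 - d k) \<le> d k"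
        using d[of k] prob_le_1[of "{\<omega> \<in> space M. \<xi> k \<omega> = 1}"]
        unfolding p by (auto simp: mult_left_le)
      then show "norm (expectation (\<lambda>\<omega>. (?X k \<omega>)\<^sup>2)) \<le> d k * (w k)\<^sup>2"
        unfolding E_sq by (simp add: abs_mult mult_right_mono)
    qed
  qed (rule int_sq)
qed

text \<open>The weight \<open>u\<^sup>2 / (1 + u)\<close> is comparable to \<open>u\<^sup>2\<close> for \<open>u \<le> 1\<close> and to \<open>u\<close> for \<open>u \<ge> 1\<close>.\<close>
lemma bernoulli_random_series:
  fixes \<xi> :: "nat \<Rightarrow> 'w \<Rightarrow> nat" and d :: "nat \<Rightarrow> real" and w :: "nat \<Rightarrow> complex"
  assumes M: "prob_space M"
    and ind: "prob_space.indep_vars M (\<lambda>_. count_space UNIV) \<xi> UNIV"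
    and vals: "\<And>k \<omega>. \<omega> \<in> space M \<Longrightarrow> \<xi> k \<omega> \<in> {0, 1}"
    and p: "\<And>k. measure M {\<omega> \<in> space M. \<xi> k \<omega> = 1} = d k"
    and w: "summable (\<lambda>k. d k * ((norm (w k))\<^sup>2 / (1 + norm (w k))))"
  shows "AE \<omega> in M. summable (\<lambda>k. (real (\<xi> k \<omega>) - d k) *\<^sub>R w k)"
proof -
  interpret prob_space M by fact
  have [measurable]: "\<xi> k \<in> measurable M (count_space UNIV)" for k
    using ind by (auto simp: indep_vars_def)
  have d: "d k \<ge> 0" for k unfolding p[symmetric] by simp
  define a where "a k = (if norm (w k) \<le> 1 then w k else 0)" for k
  define b where "b k = (if norm (w k) \<le> 1 then 0 else w k)" for k
  have w2: "summable (\<lambda>k. 2 * (d k * ((norm (w k))\<^sup>2 / (1 + norm (w k)))))"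
    by (rule summable_mult[OF w])
  have a2: "(norm (a k))\<^sup>2 \<le> 2 * ((norm (w k))\<^sup>2 / (1 + norm (w k)))" for k
  proof (cases "norm (w k) \<le> 1")
    case True
    then have "(norm (w k))\<^sup>2 * (1 + norm (w k)) \<le> (norm (w k))\<^sup>2 * 2"
      by (intro mult_left_mono) auto
    then show ?thesis using True by (simp add: a_def field_simps add_pos_nonneg)
  qed (simp add: a_def)
  have b1: "norm (b k) \<le> 2 * ((norm (w k))\<^sup>2 / (1 + norm (w k)))" for k
  proof (cases "norm (w k) \<le> 1")
    case False
    then have "norm (w k) * (1 + norm (w k)) \<le> norm (w k) * (2 * norm (w k))"
      by (intro mult_left_mono) auto
    then show ?thesis using False by (simp add: b_def field_simps add_pos_nonneg power2_eq_square)
  qed (simp add: b_def)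
  \<comment> \<open>Formulated for any real \<open>v\<close> dominated by \<open>a\<close>, to serve
    both the real and the imaginary part: the convergence theorem above is for real
    variables.\<close>
  have aux: "summable (\<lambda>k. d k * (v k)\<^sup>2)" if "\<And>k. \<bar>v k\<bar> \<le> norm (a k)" for v :: "nat \<Rightarrow> real"
  proof (rule summable_comparison_test'[OF w2, of 0])
    fix k
    have "(v k)\<^sup>2 \<le> (norm (a k))\<^sup>2" using that[of k] abs_le_square_iff[of "v k" "norm (a k)"] by simp
    then have "d k * (v k)\<^sup>2 \<le> d k * (2 * ((norm (w k))\<^sup>2 / (1 + norm (w k))))"
      using a2[of k] d by (intro mult_left_mono) auto
    then show "norm (d k * (v k)\<^sup>2) \<le> 2 * (d k * ((norm (w k))\<^sup>2 / (1 + norm (w k))))"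
      using d by (simp add: abs_mult mult.left_commute)
  qed
  have re: "AE \<omega> in M. summable (\<lambda>k. (real (\<xi> k \<omega>) - d k) * Re (a k))"
    by (rule bernoulli_random_series_L2[OF M ind vals p aux]) (auto simp: abs_Re_le_cmod)
  have im: "AE \<omega> in M. summable (\<lambda>k. (real (\<xi> k \<omega>) - d k) * Im (a k))"
    by (rule bernoulli_random_series_L2[OF M ind vals p aux]) (auto simp: abs_Im_le_cmod)
  have db: "summable (\<lambda>k. d k * norm (b k))"
  proof (rule summable_comparison_test'[OF w2, of 0])
    fix k
    show "norm (d k * norm (b k)) \<le> 2 * (d k * ((norm (w k))\<^sup>2 / (1 + norm (w k))))"
      using mult_left_mono[OF b1 d, of k k] d[of k] by (simp add: abs_mult mult.left_commute)
  qed
  \<comment> \<open>For the large coefficients the expected sum of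
    \<open>\<xi> k * norm (b k)\<close> is the convergent sum of \<open>d k * norm (b k)\<close>, so
    the random sum is almost surely finite.\<close>
  have "AE \<omega> in M. (\<Sum>k. ennreal (real (\<xi> k \<omega>) * norm (b k))) \<noteq> \<infinity>"
  proof (rule nn_integral_PInf_AE)
    have "(\<integral>\<^sup>+\<omega>. ennreal (real (\<xi> k \<omega>) * norm (b k)) \<partial>M) = ennreal (d k * norm (b k))" for k
    proof -
      have "(\<integral>\<^sup>+\<omega>. ennreal (real (\<xi> k \<omega>) * norm (b k)) \<partial>M)
          = (\<integral>\<^sup>+\<omega>. ennreal (norm (b k)) * indicator {\<omega> \<in> space M. \<xi> k \<omega> = 1} \<omega> \<partial>M)"
        using vals[of _ k] by (intro nn_integral_cong) (auto simp: indicator_def)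
      also have "\<dots> = ennreal (norm (b k)) * emeasure M {\<omega> \<in> space M. \<xi> k \<omega> = 1}"
        by (intro nn_integral_cmult_indicator) measurable
      finally show ?thesis
        using d p[of k] by (simp add: emeasure_eq_measure ennreal_mult' mult.commute)
    qed
    then have "(\<integral>\<^sup>+\<omega>. (\<Sum>k. ennreal (real (\<xi> k \<omega>) * norm (b k))) \<partial>M) = (\<Sum>k. ennreal (d k * norm (b k)))"
      by (subst nn_integral_suminf) auto
    then show "(\<integral>\<^sup>+\<omega>. (\<Sum>k. ennreal (real (\<xi> k \<omega>) * norm (b k))) \<partial>M) \<noteq> \<infinity>"
      using db d by (simp add: suminf_ennreal2)
  qed measurable
  with re im show ?thesis
  proof eventually_elim
    case (elim \<omega>)
    have "summable (\<lambda>k. (real (\<xi> k \<omega>) - d k) *\<^sub>R a k)"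
      using elim by (simp add: summable_complex_iff)
    moreover have "summable (\<lambda>k. real (\<xi> k \<omega>) * norm (b k))"
      using elim by (intro summable_suminf_not_top) auto
    then have "summable (\<lambda>k. norm (real (\<xi> k \<omega>) *\<^sub>R b k))" by simp
    then have "summable (\<lambda>k. real (\<xi> k \<omega>) *\<^sub>R b k)" by (rule summable_norm_cancel)
    moreover have "summable (\<lambda>k. norm (d k *\<^sub>R b k))" using db d by simp
    then have "summable (\<lambda>k. d k *\<^sub>R b k)" by (rule summable_norm_cancel)
    ultimately have "summable (\<lambda>k. (real (\<xi> k \<omega>) - d k) *\<^sub>R a k + (real (\<xi> k \<omega>) *\<^sub>R b k - d k *\<^sub>R b k))"
      by (intro summable_add summable_diff)
    moreover have "(real (\<xi> k \<omega>) - d k) *\<^sub>R a k + (real (\<xi> k \<omega>) *\<^sub>R b k - d k *\<^sub>R b k)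
        = (real (\<xi> k \<omega>) - d k) *\<^sub>R w k" for k
      by (simp add: a_def b_def algebra_simps)
    ultimately show ?case by simp
  qed
qed

text \<open>Split \<open>\<xi> k\<close> into \<open>\<xi> k - d k\<close> and \<open>d k\<close>.
  Kronecker's lemma disposes of the centred part, and the mean part inherits the Cesaro limit
  \<open>L\<close> because \<open>d\<close> is monotone.\<close>

lemma bernoulli_random_average:
  fixes \<xi> :: "nat \<Rightarrow> 'w \<Rightarrow> nat" and d :: "nat \<Rightarrow> real" and c :: "nat \<Rightarrow> complex"
  assumes M: "prob_space M"
    and ind: "prob_space.indep_vars M (\<lambda>_. count_space UNIV) \<xi> UNIV"
    and vals: "\<And>k \<omega>. \<omega> \<in> space M \<Longrightarrow> \<xi> k \<omega> \<in> {0, 1}"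
    and p: "\<And>k. measure M {\<omega> \<in> space M. \<xi> k \<omega> = 1} = d k"
    and d: "antimono d" and B: "filterlim B at_top sequentially"
    and B_def: "B = (\<lambda>N. 1 + (\<Sum>k<N. d k))"
    and c: "(\<lambda>N. (\<Sum>k<N. c k) /\<^sub>R real N) \<longlonglongrightarrow> L"
    and s: "summable (\<lambda>k. d k * ((norm (c k) / B (Suc k))\<^sup>2 / (1 + norm (c k) / B (Suc k))))"
  shows "AE \<omega> in M. (\<lambda>N. (\<Sum>k<N. real (\<xi> k \<omega>) *\<^sub>R c k) /\<^sub>R B N) \<longlonglongrightarrow> L"
proof -
  have d0: "d k \<ge> 0" for k unfolding p[symmetric] by simp
  have B1: "B N \<ge> 1" for N using d0 by (simp add: B_def sum_nonneg)
  have "mono B" unfolding B_def incseq_Suc_iff using d0 by simp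
  have norm_eq: "norm (c k /\<^sub>R B (Suc k)) = norm (c k) / B (Suc k)" for k
    using B1[of "Suc k"] by (simp add: divide_inverse_commute)
  have "AE \<omega> in M. summable (\<lambda>k. (real (\<xi> k \<omega>) - d k) *\<^sub>R (c k /\<^sub>R B (Suc k)))"
    using s by (intro bernoulli_random_series[OF M ind vals p]) (simp_all only: norm_eq)
  then show ?thesis
  proof eventually_elim
    case (elim \<omega>)
    have "(\<lambda>N. (\<Sum>k<N. B (Suc k) *\<^sub>R ((real (\<xi> k \<omega>) - d k) *\<^sub>R (c k /\<^sub>R B (Suc k)))) /\<^sub>R B N) \<longlonglongrightarrow> 0"
      using B1[of 0] by (intro kronecker_lemma \<open>mono B\<close> B elim) simp
    moreover have "B (Suc k) *\<^sub>R ((real (\<xi> k \<omega>) - d k) *\<^sub>R (c k /\<^sub>R B (Suc k))) = (real (\<xi> k \<omega>) - d k) *\<^sub>R c k" for k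
      using B1[of "Suc k"] by simp
    ultimately have "(\<lambda>N. (\<Sum>k<N. (real (\<xi> k \<omega>) - d k) *\<^sub>R c k) /\<^sub>R B N) \<longlonglongrightarrow> 0" by (simp only:)
    from tendsto_add[OF this weighted_average_tendsto[OF d d0 B B_def c]]
    show ?case by (simp add: sum.distrib scaleR_diff_left sum_subtractf scaleR_diff_right)
  qed
qed

section \<open>From weighted averages to averages along the enumeration of a set\<close>

lemma sum_indicator_Suc:
  fixes h :: "nat \<Rightarrow> 'b::real_vector" and R :: "nat set"
  assumes "0 \<notin> R"
  shows "(\<Sum>k<N. indicator R (Suc k) *\<^sub>R h (Suc k)) = sum h (R \<inter> {..N})"
proof -
  have "(\<Sum>k<N. indicator R (Suc k) *\<^sub>R h (Suc k)) = (\<Sum>k\<in>{1..N}. indicator R k *\<^sub>R h k)"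
    by (simp add: sum.atLeast1_atMost_eq)
  also have "\<dots> = (\<Sum>k\<in>R \<inter> {..N}. h k)"
    using assms by (intro sum.mono_neutral_cong_right) (auto simp: indicator_def Suc_le_eq intro!: Nat.gr0I)
  finally show ?thesis .
qed

lemma sum_indicator_Suc_eq_card:
  fixes R :: "nat set"
  assumes "0 \<notin> R"
  shows "(\<Sum>k<N. indicator R (Suc k)) = real (card (R \<inter> {..N}))"
  using sum_indicator_Suc[OF assms, of "\<lambda>_. 1::real" N] by simp

text \<open>The counting function of a finite set is bounded, so its quotient by \<open>B\<close>
  would tend to 0.\<close>

lemma infinite_if_counting_asymptotic:
  fixes R :: "nat set"
  assumes R: "0 \<notin> R" and B: "filterlim B at_top sequentially"
    and card: "(\<lambda>N. (\<Sum>k<N. indicator R (Suc k)) / B N) \<longlonglongrightarrow> (1::real)"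
  shows "infinite R"
proof
  assume fin: "finite R"
  have ev: "eventually (\<lambda>N. B N > 0) sequentially"
    using B unfolding filterlim_at_top_dense by blast
  have "(\<lambda>N. real (card (R \<inter> {..N})) / B N) \<longlonglongrightarrow> 0"
  proof (rule Lim_null_comparison)
    show "eventually (\<lambda>N. norm (real (card (R \<inter> {..N})) / B N) \<le> real (card R) / B N) sequentially"
      using ev by eventually_elim (simp add: divide_right_mono card_mono fin)
    show "(\<lambda>N. real (card R) / B N) \<longlonglongrightarrow> 0"
      by (rule real_tendsto_divide_at_top[OF tendsto_const B])
  qed
  moreover have "(\<lambda>N. real (card (R \<inter> {..N})) / B N) \<longlonglongrightarrow> 1"
    using card unfolding sum_indicator_Suc_eq_card[OF R] .
  ultimately show False using LIMSEQ_unique by fastforce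
qed

text \<open>Dividing the two limits cancels \<open>B\<close> and leaves the mean of \<open>g\<close>
  over the part of \<open>R\<close> up to \<open>N\<close>. Along \<open>N = enumerate R n\<close>
  this is the mean over the first \<open>n + 1\<close> elements.\<close>

lemma enumerate_average_tendsto:
  fixes g :: "nat \<Rightarrow> complex" and R :: "nat set"
  assumes R: "0 \<notin> R" and B: "filterlim B at_top sequentially"
    and card: "(\<lambda>N. (\<Sum>k<N. indicator R (Suc k)) / B N) \<longlonglongrightarrow> (1::real)"
    and avg: "(\<lambda>N. (\<Sum>k<N. indicator R (Suc k) *\<^sub>R g (Suc k)) /\<^sub>R B N) \<longlonglongrightarrow> L"
  shows "(\<lambda>N. (\<Sum>n=1..N. g (enumerate R (n - 1))) / of_nat N) \<longlonglongrightarrow> L"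
proof -
  have inf: "infinite R" by (rule infinite_if_counting_asymptotic[OF R B card])
  have ev: "eventually (\<lambda>N. B N > 0) sequentially"
    using B unfolding filterlim_at_top_dense by blast
  have lim: "(\<lambda>N. sum g (R \<inter> {..N}) /\<^sub>R real (card (R \<inter> {..N}))) \<longlonglongrightarrow> L"
  proof (rule Lim_transform_eventually)
    have "(\<lambda>N. inverse (real (card (R \<inter> {..N})) / B N) *\<^sub>R (sum g (R \<inter> {..N}) /\<^sub>R B N))
        \<longlonglongrightarrow> inverse 1 *\<^sub>R L"
      using card avg unfolding sum_indicator_Suc_eq_card[OF R] sum_indicator_Suc[OF R] by (intro tendsto_intros) auto
    then show "(\<lambda>N. inverse (real (card (R \<inter> {..N})) / B N) *\<^sub>R (sum g (R \<inter> {..N}) /\<^sub>R B N)) \<longlonglongrightarrow> L"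
      by (simp only: inverse_1 scaleR_one)
    show "eventually (\<lambda>N. inverse (real (card (R \<inter> {..N})) / B N) *\<^sub>R (sum g (R \<inter> {..N}) /\<^sub>R B N)
        = sum g (R \<inter> {..N}) /\<^sub>R real (card (R \<inter> {..N}))) sequentially"
      using ev by eventually_elim (simp add: inverse_eq_divide)
  qed
  have sm: "strict_mono (enumerate R)" using inf by (simp add: strict_mono_def)
  have img: "R \<inter> {..enumerate R n} = enumerate R ` {..<Suc n}" for n
  proof -
    have "enumerate R ` UNIV \<inter> {..enumerate R n} = enumerate R ` {..<Suc n}"
      using inf by (auto simp: less_Suc_eq_le)
    then show ?thesis by (simp only: range_enumerate[OF inf])
  qed
  have inj: "inj_on (enumerate R) A" for A
    using strict_mono_imp_inj_on[OF sm] inj_on_subset by blast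
  have "(\<lambda>n. (\<Sum>i<Suc n. g (enumerate R i)) /\<^sub>R real (Suc n)) \<longlonglongrightarrow> L"
    using LIMSEQ_subseq_LIMSEQ[OF lim sm]
    unfolding comp_def img by (simp only: card_image[OF inj] sum.reindex[OF inj] card_lessThan comp_def)
  then have "(\<lambda>n. (\<Sum>i<n. g (enumerate R i)) /\<^sub>R real n) \<longlonglongrightarrow> L"
    by (rule LIMSEQ_offset[where k=1, simplified])
  moreover have "(\<Sum>n=1..N. g (enumerate R (n - 1))) / of_nat N = (\<Sum>i<N. g (enumerate R i)) /\<^sub>R real N" for N
    by (simp add: sum.atLeast1_atMost_eq scaleR_conv_of_real divide_inverse mult.commute)
  ultimately show "(\<lambda>N. (\<Sum>n=1..N. g (enumerate R (n - 1))) / of_nat N) \<longlonglongrightarrow> L" by simp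
qed

section \<open>Dilations of the circle\<close>

lemma circle_fun_add_int:
  assumes "circle_fun f"
  shows "f (x + of_int j) = f x"
proof -
  have nat: "f (y + real n) = f y" for y n
  proof (induction n)
    case (Suc n)
    have "f (y + real (Suc n)) = f ((y + real n) + 1)" by (simp add: algebra_simps)
    then show ?case using assms Suc by (simp add: circle_fun_def)
  qed simp
  show ?thesis
  proof (cases j rule: int_cases2)
    case (nonneg n)
    then show ?thesis using nat[of x n] by simp
  next
    case (nonpos n)
    then show ?thesis using nat[of "x - real n" n] by simp
  qed
qed

text \<open>A dilation leaves \<open>[0,1)\<close>, so measurability is wanted on the whole line. It
  is checked on countably many unit intervals, where an integer translation leads back to the
  fundamental domain.\<close>

lemma circle_fun_measurable_lebesgue:
  assumes "circle_fun f" and f: "f \<in> measurable haar_circle N"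
  shows "f \<in> measurable lebesgue N"
proof (rule measurable_piecewise_restrict[where C="range (\<lambda>j::int. {real_of_int j..<real_of_int j + 1})"])
  show "space lebesgue \<subseteq> \<Union> (range (\<lambda>j::int. {real_of_int j..<real_of_int j + 1}))"
  proof
    fix x :: real
    have "x \<in> {real_of_int \<lfloor>x\<rfloor>..<real_of_int \<lfloor>x\<rfloor> + 1}" by simp
    then show "x \<in> \<Union> (range (\<lambda>j::int. {real_of_int j..<real_of_int j + 1}))" by blast
  qed
  fix A :: "real set" assume "A \<in> range (\<lambda>j::int. {real_of_int j..<real_of_int j + 1})"
  then obtain j :: int where A: "A = {real_of_int j..<real_of_int j + 1}" by blast
  then show "A \<inter> space lebesgue \<in> sets lebesgue" by simp
  have tr: "(\<lambda>x. x - real_of_int j) \<in> measurable lebesgue lebesgue"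
    using lebesgue_affine_measurable[of "\<lambda>_. 1" "- real_of_int j"] by simp
  have "(\<lambda>x. x - real_of_int j) \<in> measurable (restrict_space lebesgue A) haar_circle"
    unfolding haar_circle_def
    by (rule measurable_restrict_space3[OF tr]) (auto simp: A)
  from measurable_compose[OF this f]
  have "(\<lambda>x. f (x - real_of_int j)) \<in> measurable (restrict_space lebesgue A) N" .
  moreover have "f (x - real_of_int j) = f x" for x
    using circle_fun_add_int[OF assms(1), of x "-j"] by simp
  ultimately show "f \<in> measurable (restrict_space lebesgue A) N" by simp
qed simp

lemma nn_integral_haar_circle:
  "(\<integral>\<^sup>+x. h x \<partial>haar_circle) = (\<integral>\<^sup>+x. h x * indicator {0..<1} x \<partial>lebesgue)"
  unfolding haar_circle_def by (rule nn_integral_restrict_space) simp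

lemma measurable_circle_dilate:
  assumes "circle_fun f" "f \<in> measurable haar_circle N"
  shows "(\<lambda>x. f (c * x)) \<in> measurable haar_circle N"
proof -
  have "(\<lambda>x. c * x) \<in> measurable lebesgue lebesgue"
    by (rule measurable_cong[THEN iffD1, OF _ lebesgue_measurable_scaling[of c]]) simp
  from measurable_compose[OF this circle_fun_measurable_lebesgue[OF assms]]
  show ?thesis unfolding haar_circle_def by (rule measurable_restrict_space1)
qed

text \<open>Integrate over \<open>[0,m)\<close> in two ways: as \<open>m\<close> unit intervals with
  equal integrals by periodicity, and by the substitution \<open>y = m x\<close>. The factor
  \<open>m\<close> is non-zero and finite, so it cancels even if the integral is infinite.\<close>

lemma nn_integral_circle_dilate:
  fixes h :: "real \<Rightarrow> ennreal"
  assumes h: "circle_fun h" "h \<in> borel_measurable lebesgue" and m: "m \<ge> 1"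
  shows "(\<integral>\<^sup>+x. h (real m * x) \<partial>haar_circle) = (\<integral>\<^sup>+x. h x \<partial>haar_circle)"
proof -
  have [measurable]: "h \<in> borel_measurable lebesgue" by fact
  have [measurable]: "{a..<b} \<in> sets lebesgue" for a b :: real by simp
  have shift: "(\<integral>\<^sup>+x. h x * indicator {real j..<real j + 1} x \<partial>lebesgue) = (\<integral>\<^sup>+x. h x \<partial>haar_circle)" for j
  proof -
    have "(\<integral>\<^sup>+x. h x * indicator {real j..<real j + 1} x \<partial>lebesgue)
        = (\<integral>\<^sup>+x. h (real j + x) * indicator {real j..<real j + 1} (real j + x) \<partial>lebesgue)"
      by (subst nn_integral_real_affine_lebesgue[where c=1 and t="real j"]) auto
    also have "\<dots> = (\<integral>\<^sup>+x. h x * indicator {0..<1} x \<partial>lebesgue)"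
      using circle_fun_add_int[OF h(1), of _ "int j"]
      by (intro nn_integral_cong) (auto simp: indicator_def add.commute)
    finally show ?thesis by (simp add: nn_integral_haar_circle)
  qed
  have "of_nat m * (\<integral>\<^sup>+x. h x \<partial>haar_circle)
      = (\<Sum>j<m. \<integral>\<^sup>+x. h x * indicator {real j..<real j + 1} x \<partial>lebesgue)"
    by (simp add: shift)
  also have "\<dots> = (\<integral>\<^sup>+x. (\<Sum>j<m. h x * indicator {real j..<real j + 1} x) \<partial>lebesgue)"
    by (intro nn_integral_sum[symmetric]) measurable
  also have "\<dots> = (\<integral>\<^sup>+x. h x * indicator {0..<real m} x \<partial>lebesgue)"
  proof (intro nn_integral_cong)
    fix x
    have "(\<Sum>j<m. h x * indicator {real j..<real j + 1} x) = h x * (\<Sum>j<m. indicator {real j..<real j + 1} x)"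
      by (simp add: sum_distrib_left)
    also have "(\<Sum>j<m. indicator {real j..<real j + 1} x) = (indicator {0..<real m} x :: ennreal)"
      by (induction m) (auto simp: indicator_def)
    finally show "(\<Sum>j<m. h x * indicator {real j..<real j + 1} x) = h x * indicator {0..<real m} x" .
  qed
  also have "\<dots> = of_nat m * (\<integral>\<^sup>+x. h (real m * x) * indicator {0..<real m} (real m * x) \<partial>lebesgue)"
    using m by (subst nn_integral_real_affine_lebesgue[where c="real m" and t=0])
               (auto simp: ennreal_of_nat_eq_real_of_nat)
  also have "(\<integral>\<^sup>+x. h (real m * x) * indicator {0..<real m} (real m * x) \<partial>lebesgue)
      = (\<integral>\<^sup>+x. h (real m * x) \<partial>haar_circle)"
    unfolding nn_integral_haar_circle using m
    by (intro nn_integral_cong) (auto simp: indicator_def zero_le_mult_iff)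
  finally show ?thesis
    using m by (auto simp: ennreal_mult_cancel_left ennreal_of_nat_neq_top)
qed

section \<open>Almost everywhere convergence of the weight series along the dilates\<close>

lemma AE_summable_dilates:
  fixes d :: "nat \<Rightarrow> real" and f :: "real \<Rightarrow> complex"
  assumes d: "\<And>k. d k \<ge> 0" and B_def: "B = (\<lambda>N. 1 + (\<Sum>k<N. d k))"
    and f: "f \<in> L1_circle" and \<beta>: "\<beta> \<ge> 1" and orl: "f \<in> orlicz_space (orlicz_fun \<beta>)"
  shows "AE x in haar_circle. summable (\<lambda>k. d k *
    ((norm (f (real (Suc k) * x)) / B (Suc k))\<^sup>2 / (1 + norm (f (real (Suc k) * x)) / B (Suc k))))"
proof -
  have per: "circle_fun f" and int: "integrable haar_circle f" using f by (auto simp: L1_circle_def)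
  have fm: "f \<in> borel_measurable haar_circle" using int by simp
  have B1: "B N \<ge> 1" for N using d by (simp add: B_def sum_nonneg)
  define q where "q k t = d k * ((t / B (Suc k))\<^sup>2 / (1 + t / B (Suc k)))" for k t
  have q0: "q k t \<ge> 0" if "t \<ge> 0" for k t
    using that d[of k] B1[of "Suc k"] by (auto simp: q_def intro!: mult_nonneg_nonneg divide_nonneg_nonneg add_nonneg_nonneg)
  have [measurable]: "q k \<in> borel_measurable borel" for k
    unfolding q_def by measurable
  have [measurable]: "f \<in> borel_measurable haar_circle" by (rule fm)
  have [measurable]: "(\<lambda>x. f (real (Suc k) * x)) \<in> borel_measurable haar_circle" for k
    by (rule measurable_circle_dilate[OF per fm])
  have "AE x in haar_circle. (\<Sum>k. ennreal (q k (norm (f (real (Suc k) * x))))) \<noteq> \<infinity>"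
  proof (rule nn_integral_PInf_AE)
    have "(\<integral>\<^sup>+x. (\<Sum>k. ennreal (q k (norm (f (real (Suc k) * x))))) \<partial>haar_circle)
        = (\<Sum>k. \<integral>\<^sup>+x. ennreal (q k (norm (f (real (Suc k) * x)))) \<partial>haar_circle)"
      by (intro nn_integral_suminf) measurable
    \<comment> \<open>Each dilation is removed under its own integral; afterwards all terms share
      the argument \<open>norm (f x)\<close>, as the logarithmic bound on the series
      requires.\<close>
    also have "\<dots> = (\<Sum>k. \<integral>\<^sup>+x. ennreal (q k (norm (f x))) \<partial>haar_circle)"
    proof (intro suminf_cong nn_integral_circle_dilate[where h="\<lambda>x. ennreal (q _ (norm (f x)))"])
      fix k
      show "circle_fun (\<lambda>x. ennreal (q k (norm (f x))))" using per by (simp add: circle_fun_def)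
      show "(\<lambda>x. ennreal (q k (norm (f x)))) \<in> borel_measurable lebesgue"
        using circle_fun_measurable_lebesgue[OF per fm] by measurable
    qed simp
    also have "\<dots> = (\<integral>\<^sup>+x. (\<Sum>k. ennreal (q k (norm (f x)))) \<partial>haar_circle)"
      by (intro nn_integral_suminf[symmetric]) measurable
    also have "\<dots> \<le> (\<integral>\<^sup>+x. ennreal (norm (f x) * ln (1 + norm (f x))) \<partial>haar_circle)"
    proof (intro nn_integral_mono)
      fix x
      have "(\<Sum>k<N. ennreal (q k (norm (f x)))) \<le> ennreal (norm (f x) * ln (1 + norm (f x)))" for N
        using sum_weighted_le_mult_ln[OF d B_def, of "norm (f x)" N, folded q_def]
        by (simp add: sum_ennreal q0 ennreal_leI)
      then show "(\<Sum>k. ennreal (q k (norm (f x)))) \<le> ennreal (norm (f x) * ln (1 + norm (f x)))"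
        by (intro suminf_le_const) auto
    qed
    also have "\<dots> < \<infinity>"
    proof -
      obtain a where a: "a > 0" "(\<integral>\<^sup>+x. ennreal (orlicz_fun \<beta> (norm (f x) / a)) \<partial>haar_circle) < \<infinity>"
        using orl by (auto simp: orlicz_space_def)
      have orl0: "orlicz_fun \<beta> t \<ge> 0" if "t \<ge> 0" for t using that by (simp add: orlicz_fun_def)
      have [measurable]: "orlicz_fun \<beta> \<in> borel_measurable borel" unfolding orlicz_fun_def by measurable
      have "(\<integral>\<^sup>+x. ennreal (norm (f x) * ln (1 + norm (f x))) \<partial>haar_circle)
          \<le> (\<integral>\<^sup>+x. ennreal (1 + ln (1 + a)) * ennreal (norm (f x))
                + ennreal a * ennreal (orlicz_fun \<beta> (norm (f x) / a)) \<partial>haar_circle)"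
      proof (intro nn_integral_mono)
        fix x
        have "ennreal (norm (f x) * ln (1 + norm (f x)))
            \<le> ennreal ((1 + ln (1 + a)) * norm (f x) + a * orlicz_fun \<beta> (norm (f x) / a))"
          using mult_ln_le_orlicz_fun[OF \<beta> a(1), of "norm (f x)"] by (intro ennreal_leI) simp
        then show "ennreal (norm (f x) * ln (1 + norm (f x)))
            \<le> ennreal (1 + ln (1 + a)) * ennreal (norm (f x))
                + ennreal a * ennreal (orlicz_fun \<beta> (norm (f x) / a))"
          using a(1) orl0[of "norm (f x) / a"] by (simp add: ennreal_plus ennreal_mult)
      qed
      also have "\<dots> = ennreal (1 + ln (1 + a)) * (\<integral>\<^sup>+x. ennreal (norm (f x)) \<partial>haar_circle)
                + ennreal a * (\<integral>\<^sup>+x. ennreal (orlicz_fun \<beta> (norm (f x) / a)) \<partial>haar_circle)"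
        by (subst nn_integral_add) (auto simp: nn_integral_cmult)
      also have "\<dots> < \<infinity>"
        using a(2) int unfolding integrable_iff_bounded by (auto simp: ennreal_mult_less_top)
      finally show ?thesis .
    qed
    finally show "(\<integral>\<^sup>+x. (\<Sum>k. ennreal (q k (norm (f (real (Suc k) * x))))) \<partial>haar_circle) \<noteq> \<infinity>"
      by simp
  qed measurable
  then show ?thesis
  proof eventually_elim
    case (elim x)
    then have "summable (\<lambda>k. q k (norm (f (real (Suc k) * x))))"
      by (intro summable_suminf_not_top q0) auto
    then show ?case by (simp only: q_def)
  qed
qed

text \<open>The start is generalised to \<open>m\<close>, since removing the least element of
  \<open>{m..}\<close> gives \<open>{Suc m..}\<close>. This turns the averages in the class of the
  positive integers into Cesaro means.\<close>

lemma enumerate_atLeast_1: "enumerate {1..} n = Suc n"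
proof -
  have "enumerate {m..} n = m + n" for m
  proof (induction n arbitrary: m)
    case 0
    show ?case unfolding enumerate_0 by (rule Least_equality) auto
  next
    case (Suc n)
    have "enumerate {m..} 0 = m" unfolding enumerate_0 by (rule Least_equality) auto
    moreover have "{m..} - {m} = {Suc m..}" by auto
    ultimately show ?case using Suc[of "Suc m"] by (simp add: enumerate_Suc')
  qed
  then show ?thesis by simp
qed

section \<open>Exchange of the point and the random choice, and passage to the random set\<close>

theorem theorem5p6:
  fixes \<delta> :: "nat \<Rightarrow> real" and M :: "'w measure" and \<xi> :: "nat \<Rightarrow> 'w \<Rightarrow> nat"
    and f :: "real \<Rightarrow> complex" and \<beta> :: real
  assumes "antimono_on {1..} \<delta>"
    and "\<And>k. k \<ge> 1 \<Longrightarrow> 0 < \<delta> k \<and> \<delta> k < 1"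
    and "filterlim (\<lambda>n. \<Sum>k=1..n. \<delta> k) at_top sequentially"
    and "prob_space M"
    and "prob_space.indep_vars M (\<lambda>_. count_space UNIV) \<xi> {1..}"
    and "\<And>k \<omega>. k \<ge> 1 \<Longrightarrow> \<omega> \<in> space M \<Longrightarrow> \<xi> k \<omega> \<in> {0, 1}"
    and "\<And>k. k \<ge> 1 \<Longrightarrow> measure M {\<omega> \<in> space M. \<xi> k \<omega> = 1} = \<delta> k"
    and "f \<in> L1_circle"
    and "f \<in> khinchin_class {1..}"
    and "\<beta> > 1"
    and "f \<in> orlicz_space (orlicz_fun \<beta>)"
  shows "AE \<omega> in M. infinite (random_set \<xi> \<omega>) \<and> f \<in> khinchin_class (random_set \<xi> \<omega>)"
proof -
  interpret prob_space M by fact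
  interpret H: finite_measure haar_circle
    unfolding haar_circle_def by (rule finite_measure_lebesgue_on) (simp add: lmeasurable_iff_integrable)
  interpret S: pair_sigma_finite M haar_circle ..
  \<comment> \<open>Everything is shifted to indices from 0: position \<open>k\<close> stands for
    the integer \<open>Suc k\<close>.\<close>
  define d where "d k = \<delta> (Suc k)" for k
  define z where "z k = \<xi> (Suc k)" for k
  \<comment> \<open>The extra 1 keeps \<open>B\<close> at least 1, hence safe to divide by, and
    leaves its asymptotics unchanged.\<close>
  define B where "B = (\<lambda>N. 1 + (\<Sum>k<N. d k))"
  define L where "L = integral\<^sup>L haar_circle f"
  have d0: "d k \<ge> 0" for k using assms(2)[of "Suc k"] by (simp add: d_def)
  have d: "antimono d" using assms(1) unfolding monotone_on_def d_def by auto
  have B: "filterlim B at_top sequentially"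
    using filterlim_tendsto_add_at_top[OF tendsto_const assms(3), of 1]
    by (simp add: B_def d_def sum.atLeast1_atMost_eq)
  have ind: "indep_vars (\<lambda>_. count_space UNIV) z UNIV"
  proof -
    have "indep_vars (\<lambda>_. count_space UNIV) \<xi> {1..}" by (rule assms(5))
    then show ?thesis
      unfolding z_def by (rule indep_vars_Suc)
  qed
  have vals: "\<omega> \<in> space M \<Longrightarrow> z k \<omega> \<in> {0, 1}" for k \<omega>
    using assms(6)[of "Suc k" \<omega>] by (simp add: z_def)
  have p: "prob {\<omega> \<in> space M. z k \<omega> = 1} = d k" for k
    using assms(7)[of "Suc k"] by (simp add: z_def d_def)
  note average = bernoulli_random_average[OF \<open>prob_space M\<close> ind vals p d B B_def]
  have per: "circle_fun f" and fm: "f \<in> borel_measurable haar_circle"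
    using assms(8) by (auto simp: L1_circle_def)

  \<comment> \<open>The constant sequence 1 yields the law of large numbers for the counting
    function of the random set. It is complex to fit \<open>average\<close>; the real part is taken
    below.\<close>
  have count: "AE \<omega> in M. (\<lambda>N. (\<Sum>k<N. real (z k \<omega>) *\<^sub>R (1::complex)) /\<^sub>R B N) \<longlonglongrightarrow> 1"
  proof (rule average)
    show "(\<lambda>N. (\<Sum>k<N. 1::complex) /\<^sub>R real N) \<longlonglongrightarrow> 1"
    proof (rule Lim_transform_eventually[OF tendsto_const])
      show "eventually (\<lambda>N. 1 = (\<Sum>k<N. 1::complex) /\<^sub>R real N) sequentially"
        using eventually_gt_at_top[of 0] by eventually_elim (simp add: scaleR_conv_of_real)
    qed
    have "B N \<ge> 1" for N using d0 by (simp add: B_def sum_nonneg)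
    then show "summable (\<lambda>k. d k * ((norm (1::complex) / B (Suc k))\<^sup>2 / (1 + norm (1::complex) / B (Suc k))))"
      using sum_weighted_le_mult_ln[OF d0 B_def, of 1] d0
      by (intro summableI_nonneg_bounded[where x="ln 2"] mult_nonneg_nonneg divide_nonneg_nonneg add_nonneg_nonneg)
         (auto intro: order.trans[OF zero_le_one])
  qed

  have "AE x in haar_circle. (\<lambda>N. (\<Sum>n=1..N. f (real (enumerate {1..} (n - 1)) * x)) / of_nat N) \<longlonglongrightarrow> L"
    using assms(9) by (simp add: khinchin_class_def L_def)
  then have cesaro: "AE x in haar_circle. (\<lambda>N. (\<Sum>k<N. f (real (Suc k) * x)) /\<^sub>R real N) \<longlonglongrightarrow> L"
    by (simp add: enumerate_atLeast_1[simplified] sum.atLeast1_atMost_eq scaleR_conv_of_real divide_inverse mult.commute[of _ "inverse _"])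
  let ?P = "\<lambda>\<omega> x. (\<lambda>N. (\<Sum>k<N. real (z k \<omega>) *\<^sub>R f (real (Suc k) * x)) /\<^sub>R B N) \<longlonglongrightarrow> L"
  have "AE x in haar_circle. AE \<omega> in M. ?P \<omega> x"
    using cesaro AE_summable_dilates[OF d0 B_def assms(8) less_imp_le[OF assms(10)] assms(11)]
    by eventually_elim (rule average)
  \<comment> \<open>Joint measurability of the set of convergence, which Fubini demands for
    exchanging the two almost-everywhere quantifiers.\<close>
  moreover have "{y \<in> space (M \<Otimes>\<^sub>M haar_circle). ?P (fst y) (snd y)} \<in> sets (M \<Otimes>\<^sub>M haar_circle)"
  proof -
    have [measurable]: "(\<lambda>x. f (real (Suc k) * x)) \<in> borel_measurable haar_circle" for k
      by (rule measurable_circle_dilate[OF per fm])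
    have [measurable]: "z k \<in> measurable M (count_space UNIV)" for k
      using ind by (auto simp: indep_vars_def)
    have [measurable]: "(\<lambda>\<omega>. real (z k \<omega>)) \<in> borel_measurable M" for k
      by (rule measurable_compose[of "z k" M "count_space UNIV" real borel]) auto
    show ?thesis by measurable
  qed
  ultimately have "AE \<omega> in M. AE x in haar_circle. ?P \<omega> x"
    using S.AE_commute[of ?P] by simp
  with count show ?thesis
  proof (rule AE_mp[OF _ AE_mp], intro AE_I2 impI)
    fix \<omega> assume \<omega>: "\<omega> \<in> space M"
      and 1: "(\<lambda>N. (\<Sum>k<N. real (z k \<omega>) *\<^sub>R (1::complex)) /\<^sub>R B N) \<longlonglongrightarrow> 1"
      and 2: "AE x in haar_circle. ?P \<omega> x"
    let ?R = "random_set \<xi> \<omega>"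
    have z: "real (z k \<omega>) = indicator ?R (Suc k)" for k
      using vals[OF \<omega>, of k] by (auto simp: random_set_def z_def)
    have "(\<lambda>N. Re ((\<Sum>k<N. real (z k \<omega>) *\<^sub>R (1::complex)) /\<^sub>R B N)) \<longlonglongrightarrow> Re 1"
      by (rule tendsto_Re[OF 1])
    then have card: "(\<lambda>N. (\<Sum>k<N. indicator ?R (Suc k)) / B N) \<longlonglongrightarrow> (1::real)"
      by (simp add: z[symmetric] divide_inverse mult.commute)
    have R0: "0 \<notin> ?R" by (simp add: random_set_def)
    have "AE x in haar_circle.
        (\<lambda>N. (\<Sum>n=1..N. f (real (enumerate ?R (n - 1)) * x)) / of_nat N) \<longlonglongrightarrow> L"
      using 2 by eventually_elim (rule enumerate_average_tendsto[OF R0 B card, of "\<lambda>n. f (real n * _)"], simp only: z)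
    moreover have "infinite ?R" by (rule infinite_if_counting_asymptotic[OF R0 B card])
    ultimately show "infinite ?R \<and> f \<in> khinchin_class ?R"
      using assms(8) by (simp add: khinchin_class_def L_def)
  qed
qed

end
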